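(* There is a universal constant $K>0$ such that for every integer $d\ge1$, every instance space $\mathcal{X}$ and every $T\ge1$, there exists an online learning algorithm for the family of concept classes $\mathcal{C}\subseteq\{0,1\}^{\mathcal{X}}$ with Littlestone dimension $d$ that, in the realizable setting, makes at most $T\cdot 2^{Kd}$ calls to the weak consistency oracle and at most $2^{Kd}$ mistakes over $T$ rounds (i.e. $T\cdot 2^{O(d)}$ oracle calls and $2^{O(d)}$ mistakes).
   Context: Online learning with oracle access (realizable setting). Let $\mathcal{X}$ be an instance space and $\mathcal{F}$ a family of (nonempty) concept classes $\mathcal{C}\subseteq\{0,1\}^{\mathcal{X}}$. The learner knows $\mathcal{F}$ and $T$. The adversary fixes an unknown $\mathcal{C}\in\mathcal{F}$, a target $c\in\mathcal{C}$ and a sequence $x_{1:T}\in\mathcal{X}^T$. The learner can access $\mathcal{C}$ only by querying an oracle. In round $t=1,\dots,T$: the learner observes $x_t$, may make oracle queries, predicts $\hat y_t\in\{0,1\}$; then $y_t=c(x_t)$ is revealed, and a mistake occurs if $\hat y_t\neq y_t$. Bounds on mistakes and oracle calls are worst case over $\mathcal{C}\in\mathcal{F}$, $c\in\mathcal{C}$ and $x_{1:T}\in\mathcal{X}^T$. Weak consistency oracle: given any finite sequence $S=(x_1,y_1),\dots,(x_n,y_n)$ in $\mathcal{X}\times\{0,1\}$, it returns "realizable" if some $c'\in\mathcal{C}$ is consistent with $S$, and "not realizable" otherwise. Littlestone dimension of $\mathcal{C}$: the largest depth $n$ of a complete binary tree whose internal nodes are labeled by points of $\mathcal{X}$ such that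 for every root-to-leaf path, with edge labels $y_1,\dots,y_n\in\{0,1\}$ and visited nodes $x_1,\dots,x_n$, some $c\in\mathcal{C}$ has $c(x_i)=y_i$ for all $i$. *)

theory Defs
  imports Complex_Main "HOL-Library.Extended_Nat" "HOL-Library.Tree"
begin

type_synonym 'a sample = "('a \<times> bool) list"

definition consistent :: "('a \<Rightarrow> bool) \<Rightarrow> 'a sample \<Rightarrow> bool" where
  "consistent c S \<longleftrightarrow> (\<forall>(x, y) \<in> set S. c x = y)"

definition realizable :: "('a \<Rightarrow> bool) set \<Rightarrow> 'a sample \<Rightarrow> bool" where
  "realizable C S \<longleftrightarrow> (\<exists>c\<in>C. consistent c S)"

type_synonym 'a sample_oracle = "'a sample \<Rightarrow> bool"

definition weak_consistency_oracle :: "('a \<Rightarrow> bool) set \<Rightarrow> 'a sample_oracle" where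
  "weak_consistency_oracle C = (\<lambda>S. realizable C S)"

fun branch :: "'a tree \<Rightarrow> bool list \<Rightarrow> 'a sample" where
  "branch (Node l x r) (y # ys) = (x, y) # branch (if y then r else l) ys"
| "branch _ _ = []"

definition shattered :: "('a \<Rightarrow> bool) set \<Rightarrow> 'a tree \<Rightarrow> bool" where
  "shattered C t \<longleftrightarrow> complete t \<and> (\<forall>ys. length ys = height t \<longrightarrow> realizable C (branch t ys))"

(* The value is \<infinity> if trees of unbounded depth are shattered. *)
definition littlestone_dim :: "('a \<Rightarrow> bool) set \<Rightarrow> enat" where
  "littlestone_dim C = Sup {enat (height t) | t. shattered C t}"

definition littlestone_family :: "nat \<Rightarrow> ('a \<Rightarrow> bool) set set" where
  "littlestone_family d = {C. C \<noteq> {} \<and> littlestone_dim C = enat d}"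

(* What a learner does within one round: finitely many adaptive oracle queries, each
   continuing according to the answer, and then a prediction. *)
datatype 'a strategy = Predict bool | Query "'a sample" "bool \<Rightarrow> 'a strategy"

primrec queries :: "'a sample_oracle \<Rightarrow> 'a strategy \<Rightarrow> ('a sample \<times> bool) list" where
  "queries Orc (Predict b) = []"
| "queries Orc (Query S k) = (S, Orc S) # queries Orc (k (Orc S))"

primrec outcome :: "'a sample_oracle \<Rightarrow> 'a strategy \<Rightarrow> bool" where
  "outcome Orc (Predict b) = b"
| "outcome Orc (Query S k) = outcome Orc (k (Orc S))"

datatype 'a round =
  Round (point: 'a) (exchanges: "('a sample \<times> bool) list") (prediction: bool) (label: bool)

(* A deterministic learner. It sees the complete transcript of the past rounds (oldest
   first, including all oracle answers) and the current point, but neither the class nor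
   the target. *)
type_synonym 'a learner = "'a round list \<Rightarrow> 'a \<Rightarrow> 'a strategy"

definition play_round ::
  "'a learner \<Rightarrow> 'a sample_oracle \<Rightarrow> ('a \<Rightarrow> bool) \<Rightarrow> 'a round list \<Rightarrow> 'a \<Rightarrow> 'a round" where
  "play_round L Orc c h x = Round x (queries Orc (L h x)) (outcome Orc (L h x)) (c x)"

definition play ::
  "'a learner \<Rightarrow> 'a sample_oracle \<Rightarrow> ('a \<Rightarrow> bool) \<Rightarrow> 'a list \<Rightarrow> 'a round list" where
  "play L Orc c xs = foldl (\<lambda>h x. h @ [play_round L Orc c h x]) [] xs"

definition mistakes :: "'a round list \<Rightarrow> nat" where
  "mistakes h = length (filter (\<lambda>r. prediction r \<noteq> label r) h)"

definition oracle_calls :: "'a round list \<Rightarrow> nat" where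
  "oracle_calls h = (\<Sum>r\<leftarrow>h. length (exchanges r))"

(* The instance space is the type 'a. HOL quantifies types outermost, so a bare
   "\<exists>K. ..." about 'a learners would allow K to depend on the instance space. A constant
   meant to be universal is therefore required to lie below one numeral shared by all
   types; the bounds considered here are monotone in K, so this numeral itself is then a
   constant valid for every instance space. *)

end

theory Submission
  imports Defs "HOL-Computational_Algebra.Primes"
begin

text \<open>
  The learner keeps worlds \<open>W\<^sub>0, \<dots>, W\<^sub>m\<close>, where \<open>m\<close> is the number of mistakes so far: \<open>W\<^sub>j\<close> is a
  realizable labelling of the mistake points which is correct on the first \<open>j\<close> of them and which
  is extended to every later one by a single oracle query. If \<open>v\<close> is the largest power of two
  dividing \<open>i\<close>, then up to the \<open>i\<close>-th mistake the learner predicts by the majority of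
  \<open>W\<^bsub>i - v\<^esub>, \<dots>, W\<^bsub>i - 1\<^esub>\<close>.

  In the complete binary tree with leaves \<open>0, \<dots>, 2\<^sup>n - 1\<close> and inner nodes \<open>1, \<dots>, 2\<^sup>n - 1\<close> in
  in-order, the leaves in the left subtree of \<open>i\<close> are exactly the voters \<open>i - v, \<dots>, i - 1\<close>, at
  least half of which are wrong at the \<open>i\<close>-th mistake, while all leaves to the right of \<open>i\<close> are
  correct there. A leaf to the left of \<open>i\<close> that is wrong at \<open>i\<close> is marked by \<open>i\<close>. A subtree on whose
  branching nodes all leaves to the left are marked is shattered. If a set of leaves contains no such
  subtree of depth \<open>k\<close>, then giving weight \<open>2\<close> to the power of the number of marks to each leaf makes its
  total weight at most \<open>(17/8)\<^sup>n 16\<^sup>k\<close>; but by convexity the weight of all leaves is at least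
  \<open>2\<^sup>n 2\<^bsup>n/4\<^esup>\<close>. So \<open>n\<close>, and with it the logarithm of the number of mistakes, is linear in \<open>k\<close>.
\<close>

section \<open>Shattered trees from dyadic majorities\<close>

text \<open>Shattering with the class abstracted away: every path of the tree lies inside one row.
  Realizable rows turn it back into shattering.\<close>

definition covers :: "('i \<Rightarrow> 'a sample) \<Rightarrow> 'i set \<Rightarrow> nat \<Rightarrow> bool" where
  "covers row A k \<longleftrightarrow> (\<exists>t. complete t \<and> height t = k \<and>
     (\<forall>ys. length ys = k \<longrightarrow> (\<exists>j\<in>A. set (branch t ys) \<subseteq> set (row j))))"

lemma covers_0: "covers row A 0 \<longleftrightarrow> A \<noteq> {}"
  by (auto simp: covers_def intro!: exI[of _ Leaf])

lemma covers_mono: "covers row A k \<Longrightarrow> A \<subseteq> B \<Longrightarrow> covers row B k"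
  unfolding covers_def by blast

text \<open>The point \<open>x\<close> becomes the root, with the tree for \<open>Q\<close> on its
  \<open>y\<close> side and the tree for \<open>P\<close> on the other; the two trees may
  differ.\<close>

lemma covers_Suc:
  assumes "covers row P k" "covers row Q k" "P \<subseteq> A" "Q \<subseteq> A"
    and P: "\<And>j. j \<in> P \<Longrightarrow> (x, \<not> y) \<in> set (row j)" and Q: "\<And>j. j \<in> Q \<Longrightarrow> (x, y) \<in> set (row j)"
  shows "covers row A (Suc k)"
proof -
  obtain p where p: "complete p" "height p = k"
    "\<And>ys. length ys = k \<Longrightarrow> \<exists>j\<in>P. set (branch p ys) \<subseteq> set (row j)"
    using assms(1) unfolding covers_def by blast
  obtain q where q: "complete q" "height q = k"
    "\<And>ys. length ys = k \<Longrightarrow> \<exists>j\<in>Q. set (branch q ys) \<subseteq> set (row j)"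
    using assms(2) unfolding covers_def by blast
  define t where "t = (if y then Node p x q else Node q x p)"
  have "\<exists>j\<in>A. set (branch t ys) \<subseteq> set (row j)" if len: "length ys = Suc k" for ys
  proof -
    obtain b bs where ys: "ys = b # bs" "length bs = k"
      using len by (auto simp: length_Suc_conv)
    show ?thesis
    proof (cases "b = y")
      case True
      then have "branch t ys = (x, y) # branch q bs" by (simp add: t_def ys)
      moreover obtain j where "j \<in> Q" "set (branch q bs) \<subseteq> set (row j)" using q(3) ys by blast
      ultimately show ?thesis using Q assms(4) by (intro bexI[of _ j]) auto
    next
      case False
      then have "branch t ys = (x, \<not> y) # branch p bs" by (auto simp: t_def ys)
      moreover obtain j where "j \<in> P" "set (branch p bs) \<subseteq> set (row j)" using p(3) ys by blast
      ultimately show ?thesis using P assms(3) by (intro bexI[of _ j]) auto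
    qed
  qed
  moreover have "complete t" "height t = Suc k" using p q by (auto simp: t_def)
  ultimately show ?thesis unfolding covers_def by blast
qed

lemma realizable_subset:
  assumes "realizable C S" "set S' \<subseteq> set S"
  shows "realizable C S'"
proof -
  obtain c where "c \<in> C" "consistent c S" using assms(1) by (auto simp: realizable_def)
  moreover from this have "consistent c S'" using assms(2) by (auto simp: consistent_def)
  ultimately show ?thesis by (auto simp: realizable_def)
qed

lemma covers_imp_littlestone_dim_ge:
  assumes "covers row A k" and "\<And>j. j \<in> A \<Longrightarrow> realizable C (row j)"
  shows "enat k \<le> littlestone_dim C"
proof -
  obtain t where t: "complete t" "height t = k"
    "\<And>ys. length ys = k \<Longrightarrow> \<exists>j\<in>A. set (branch t ys) \<subseteq> set (row j)"
    using assms(1) unfolding covers_def by blast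
  have "realizable C (branch t ys)" if ys: "length ys = k" for ys
  proof -
    obtain j where "j \<in> A" "set (branch t ys) \<subseteq> set (row j)" using t(3)[OF ys] by blast
    then show ?thesis using assms(2) realizable_subset by blast
  qed
  then have "shattered C t" using t by (simp add: shattered_def)
  then have "enat (height t) \<in> {enat (height t) | t. shattered C t}" by blast
  then show ?thesis unfolding littlestone_dim_def t(2)[symmetric] by (rule Sup_upper)
qed

section \<open>Dyadic blocks of leaves and their in-order nodes\<close>

definition block :: "nat \<Rightarrow> nat \<Rightarrow> nat set" where
  "block n b = {j. j div 2 ^ n = b}"

lemma block_eq: "block n b = {b * 2 ^ n ..< Suc b * 2 ^ n}"
proof (rule set_eqI)
  fix j
  have "j div 2 ^ n = b \<longleftrightarrow> b \<le> j div 2 ^ n \<and> j div 2 ^ n < Suc b" by auto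
  also have "\<dots> \<longleftrightarrow> b * 2 ^ n \<le> j \<and> j < Suc b * 2 ^ n"
    by (simp only: less_eq_div_iff_mult_less_eq div_less_iff_less_mult zero_less_power zero_less_numeral)
  finally show "j \<in> block n b \<longleftrightarrow> j \<in> {b * 2 ^ n ..< Suc b * 2 ^ n}"
    by (simp only: block_def mem_Collect_eq atLeastLessThan_iff)
qed

lemma finite_block [simp]: "finite (block n b)"
  by (simp add: block_eq)

lemma card_block [simp]: "card (block n b) = 2 ^ n"
  unfolding block_eq card_atLeastLessThan mult_Suc by (rule add_diff_cancel_right')

lemma block_Suc: "block (Suc n) a = block n (2 * a) \<union> block n (Suc (2 * a))"
proof (rule set_eqI)
  fix j :: nat
  have "j div 2 ^ Suc n = j div 2 ^ n div 2"
    by (simp only: power_Suc2 div_mult2_eq)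
  moreover have "i div 2 = a \<longleftrightarrow> i = 2 * a \<or> i = Suc (2 * a)" for i :: nat
    by presburger
  ultimately show "j \<in> block (Suc n) a \<longleftrightarrow> j \<in> block n (2 * a) \<union> block n (Suc (2 * a))"
    by (simp only: block_def mem_Collect_eq Un_iff)
qed

lemma block_disjoint: "b \<noteq> b' \<Longrightarrow> block n b \<inter> block n b' = {}"
  by (auto simp: block_def)

definition voters :: "nat \<Rightarrow> nat set" where
  "voters i = {i - 2 ^ multiplicity 2 i ..< i}"

lemma finite_voters [simp]: "finite (voters i)"
  by (simp add: voters_def)

lemma voters_less: "j \<in> voters i \<Longrightarrow> j < i"
  by (simp add: voters_def)

text \<open>The odd cofactor makes the multiplicity of 2 exactly \<open>n\<close>. The number is
  that of the inner node with left leaves \<open>block n (2 * a)\<close> and right leaves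
  \<open>block n (Suc (2 * a))\<close>.\<close>

lemma voters_node: "voters (Suc (2 * a) * 2 ^ n) = block n (2 * a)"
proof -
  have "2 * 2 ^ n dvd Suc (2 * a) * 2 ^ n \<longleftrightarrow> 2 dvd Suc (2 * a)"
    by (rule dvd_times_right_cancel_iff) simp
  then have "\<not> 2 ^ Suc n dvd Suc (2 * a) * 2 ^ n" by simp
  then have "multiplicity 2 (Suc (2 * a) * 2 ^ n) = n"
    by (intro multiplicity_eqI) (auto simp del: mult_Suc)
  moreover have "Suc (2 * a) * 2 ^ n - 2 ^ n = 2 * a * 2 ^ n" by simp
  ultimately show ?thesis by (simp only: voters_def block_eq)
qed

text \<open>
  The \<open>i\<close>-th mistake is at the point \<open>fst (z (i - 1))\<close>, with true label \<open>snd (z (i - 1))\<close>.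
\<close>

locale dyadic_majority =
  fixes row :: "nat \<Rightarrow> 'a sample" and z :: "nat \<Rightarrow> 'a \<times> bool" and N :: nat
  assumes correct: "\<And>i j. 0 < i \<Longrightarrow> i \<le> j \<Longrightarrow> j < N \<Longrightarrow> z (i - 1) \<in> set (row j)"
    and wrong: "\<And>i. 0 < i \<Longrightarrow> i < N \<Longrightarrow>
      card (voters i) \<le> 2 * card {j \<in> voters i.
        (fst (z (i - 1)), \<not> snd (z (i - 1))) \<in> set (row j)}"
begin

section \<open>Marks of leaves and the weight bound\<close>

definition marked :: "nat \<Rightarrow> nat \<Rightarrow> bool" where
  "marked i j \<longleftrightarrow> (fst (z (i - 1)), \<not> snd (z (i - 1))) \<in> set (row j)"

text \<open>Counts the marks of leaf \<open>j\<close> from its ancestors of height at most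
  \<open>n\<close>. The ancestor of height \<open>Suc n\<close> has \<open>j\<close> on its left iff
  \<open>j div 2 ^ n\<close> is even, and then its in-order number is
  \<open>Suc (j div 2 ^ n) * 2 ^ n\<close>.\<close>

fun marks :: "nat \<Rightarrow> nat \<Rightarrow> nat" where
  "marks 0 j = 0"
| "marks (Suc n) j = marks n j +
     of_bool (even (j div 2 ^ n) \<and> marked (Suc (j div 2 ^ n) * 2 ^ n) j)"

lemma marks_left:
  "j \<in> block n (2 * a) \<Longrightarrow>
   marks (Suc n) j = marks n j + of_bool (marked (Suc (2 * a) * 2 ^ n) j)"
  by (simp add: block_def)

lemma marks_right: "j \<in> block n (Suc (2 * a)) \<Longrightarrow> marks (Suc n) j = marks n j"
  by (simp add: block_def)

lemma half_marked:
  assumes "Suc (2 * a) * 2 ^ n < N"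
  shows "2 ^ n \<le> 2 * card {j \<in> block n (2 * a). marked (Suc (2 * a) * 2 ^ n) j}"
  using wrong[OF _ assms] by (simp only: voters_node card_block marked_def) simp

text \<open>At each of the \<open>n\<close> levels half of the leaves lie to the left of their
  ancestor, and at least half of those are marked, so a leaf has on average at least
  \<open>n / 4\<close> marks.\<close>

lemma sum_marks_ge:
  "Suc a * 2 ^ n \<le> N \<Longrightarrow> n * 2 ^ n \<le> 4 * (\<Sum>j\<in>block n a. marks n j)"
proof (induction n arbitrary: a)
  case (Suc n)
  let ?L = "block n (2 * a)" and ?R = "block n (Suc (2 * a))" and ?i = "Suc (2 * a) * 2 ^ n :: nat"
  have N: "Suc (2 * a) * 2 ^ n < N" "Suc (Suc (2 * a)) * 2 ^ n \<le> N"
  proof -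
    have "Suc (Suc (2 * a)) * 2 ^ n \<le> N" using Suc.prems by (simp add: algebra_simps)
    moreover have "Suc (2 * a) * 2 ^ n < Suc (Suc (2 * a)) * 2 ^ n" by simp
    ultimately show "Suc (2 * a) * 2 ^ n < N" "Suc (Suc (2 * a)) * 2 ^ n \<le> N" by linarith+
  qed
  have "(\<Sum>j\<in>?L. marks (Suc n) j) = (\<Sum>j\<in>?L. marks n j + of_bool (marked ?i j))"
    by (rule sum.cong) (auto simp: marks_left simp del: marks.simps)
  also have "\<dots> = (\<Sum>j\<in>?L. marks n j) + card {j \<in> ?L. marked ?i j}"
    by (simp add: sum.distrib Int_def)
  finally have L: "(\<Sum>j\<in>?L. marks (Suc n) j) = (\<Sum>j\<in>?L. marks n j) + card {j \<in> ?L. marked ?i j}" .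
  have R: "(\<Sum>j\<in>?R. marks (Suc n) j) = (\<Sum>j\<in>?R. marks n j)"
    by (rule sum.cong) (auto simp: marks_right simp del: marks.simps)
  have split: "(\<Sum>j\<in>block (Suc n) a. marks (Suc n) j)
      = (\<Sum>j\<in>?L. marks (Suc n) j) + (\<Sum>j\<in>?R. marks (Suc n) j)"
    unfolding block_Suc by (rule sum.union_disjoint) (auto simp: block_disjoint)
  have "Suc n * 2 ^ Suc n = n * 2 ^ n + 2 * 2 ^ n + n * 2 ^ n" by simp
  also have "\<dots> \<le> 4 * (\<Sum>j\<in>?L. marks n j) + 2 * (2 * card {j \<in> ?L. marked ?i j})
      + 4 * (\<Sum>j\<in>?R. marks n j)"
    using N half_marked by (intro add_mono mult_left_mono Suc.IH) (auto simp del: mult_Suc)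
  also have "\<dots> = 4 * (\<Sum>j\<in>block (Suc n) a. marks (Suc n) j)"
    unfolding split L R by simp
  finally show ?case .
qed simp

text \<open>By induction on the height. The left leaves split into the marked \<open>V\<close>,
  whose weight doubles at the new node, and the unmarked \<open>U\<close>; the right leaves
  \<open>R\<close> keep their weight. If \<open>V\<close> and \<open>R\<close> both covered depth
  \<open>k - 1\<close>, the node would be a root for depth \<open>k\<close>; so one of them obeys a
  bound smaller by a factor of 16.\<close>

lemma weight_le_if_not_covers:
  "A \<subseteq> block n a \<Longrightarrow> A \<subseteq> {..<N} \<Longrightarrow> \<not> covers row A k \<Longrightarrow>
   (\<Sum>j\<in>A. 2 ^ marks n j :: real) \<le> (17 / 8) ^ n * 16 ^ k"
proof (induction n arbitrary: a A k)
  case 0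
  show ?case
  proof (cases k)
    case 0
    then show ?thesis using "0.prems" by (simp add: covers_0)
  next
    case (Suc k')
    have "card A \<le> card (block 0 a)" using "0.prems" by (intro card_mono) auto
    then have "real (card A) \<le> 1" by simp
    also have "1 \<le> (16::real) ^ k" by simp
    finally show ?thesis by simp
  qed
next
  case (Suc n)
  show ?case
  proof (cases k)
    case 0
    then show ?thesis using Suc.prems by (simp add: covers_0)
  next
    case k: (Suc k')
    let ?i = "Suc (2 * a) * 2 ^ n :: nat"
    let ?w = "\<lambda>m B. \<Sum>j\<in>B. 2 ^ marks m j :: real"
    define w where "w B = ?w n B" for B
    define q :: real where "q = (17 / 8) ^ n * 16 ^ k'"
    define V where "V = {j \<in> A \<inter> block n (2 * a). marked ?i j}"
    define U where "U = {j \<in> A \<inter> block n (2 * a). \<not> marked ?i j}"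
    define R where "R = A \<inter> block n (Suc (2 * a))"
    have A: "A = V \<union> U \<union> R" using Suc.prems(1) by (auto simp: V_def U_def R_def block_Suc)
    have fin: "finite V" "finite U" "finite R" by (auto simp: V_def U_def R_def)
    have disj: "(V \<union> U) \<inter> R = {}" "V \<inter> U = {}"
      using block_disjoint[of "2 * a" "Suc (2 * a)" n] by (auto simp: V_def U_def R_def)
    have "?w (Suc n) V = (\<Sum>j\<in>V. 2 * 2 ^ marks n j)"
      by (rule sum.cong) (auto simp: V_def marks_left simp del: marks.simps)
    moreover have "?w (Suc n) U = ?w n U" "?w (Suc n) R = ?w n R"
      by (rule sum.cong; auto simp: U_def R_def marks_left marks_right simp del: marks.simps)+
    moreover have "?w (Suc n) A = ?w (Suc n) V + ?w (Suc n) U + ?w (Suc n) R"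
      unfolding A using fin disj by (subst sum.union_disjoint; simp add: sum.union_disjoint del: marks.simps)
    ultimately have weight: "?w (Suc n) A = 2 * w V + w U + w R"
      by (simp only: w_def sum_distrib_left)
    have bound: "w B \<le> (17 / 8) ^ n * 16 ^ l"
      if "B \<subseteq> block n b" "B \<subseteq> A" "\<not> covers row B l" for B b l
      unfolding w_def using that Suc.prems(2) by (intro Suc.IH) auto
    \<comment> \<open>The base \<open>17 / 8 = 34 / 16\<close> comes from the worse case below,
      which gives \<open>2 * q + 16 * q + 16 * q\<close>.\<close>
    have q: "(17 / 8) ^ n * 16 ^ k = 16 * q" "(17 / 8) ^ Suc n * 16 ^ k = 34 * q"
      by (simp_all add: q_def k)
    have not_covers: "\<not> covers row B k" if "B \<subseteq> A" for B
      using Suc.prems(3) covers_mono that by blast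
    have sub: "V \<union> U \<subseteq> block n (2 * a)" "V \<subseteq> block n (2 * a)" "U \<subseteq> block n (2 * a)"
      "R \<subseteq> block n (Suc (2 * a))" "V \<subseteq> A" "U \<subseteq> A" "R \<subseteq> A"
      by (auto simp: V_def U_def R_def)
    have "\<not> (covers row V k' \<and> covers row R k')"
    proof
      assume "covers row V k' \<and> covers row R k'"
      \<comment> \<open>\<open>R\<close> starts no earlier than leaf \<open>?i\<close>, so its rows
        carry the true label at the point of the node, whereas those of \<open>V\<close> carry the
        false one.\<close>
      moreover have "(fst (z (?i - 1)), snd (z (?i - 1))) \<in> set (row j)" if "j \<in> R" for j
        using correct[of ?i j] that Suc.prems(2) by (auto simp: R_def block_eq)
      ultimately have "covers row A (Suc k')"
        using sub by (intro covers_Suc[of row V k' R A "fst (z (?i - 1))" "snd (z (?i - 1))"])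
          (auto simp: V_def marked_def)
      then show False using Suc.prems(3) k by simp
    qed
    then consider "\<not> covers row V k'" | "\<not> covers row R k'" by blast
    then have "2 * w V + w U + w R \<le> 34 * q"
    proof cases
      case 1
      then have "w V \<le> q" using bound[of V "2 * a" k'] sub by (simp add: q_def)
      moreover have "w U \<le> 16 * q" "w R \<le> 16 * q"
        using bound[of U "2 * a" k] bound[of R "Suc (2 * a)" k] not_covers sub by (simp_all add: q)
      ultimately show ?thesis by linarith
    next
      case 2
      then have "w R \<le> q" using bound[of R "Suc (2 * a)" k'] sub by (simp add: q_def)
      \<comment> \<open>Bounding \<open>2 * w V + w U\<close> by \<open>2 * w (V \<union> U)\<close>
        gives \<open>33 * q\<close> in total.\<close>
      moreover have "w (V \<union> U) \<le> 16 * q"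
        using bound[of "V \<union> U" "2 * a" k] not_covers sub by (simp add: q)
      moreover have "w (V \<union> U) = w V + w U"
        unfolding w_def using fin disj by (intro sum.union_disjoint) auto
      moreover have "0 \<le> w U" "0 \<le> q" by (simp_all add: w_def q_def sum_nonneg)
      ultimately show ?thesis by linarith
    qed
    then show ?thesis by (simp only: weight q)
  qed
qed

text \<open>The left side is twice the line through the values of \<open>2 ^ m\<close> at
  \<open>m = s - 1\<close> and \<open>m = s\<close>, which lies below this convex function at all
  integers. Summed over the leaves, it takes the place of Jensen's inequality.\<close>

lemma two_power_ge_tangent: "(2::real) ^ s * (2 + real m - real s) \<le> 2 * 2 ^ m"
proof (cases "s \<le> m")
  case True
  then obtain r where m: "m = s + r" using le_Suc_ex by blast
  have "real (Suc r) \<le> real (2 ^ r)" by (intro of_nat_mono Suc_leI less_exp)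
  moreover have "(1::real) \<le> 2 ^ r" by simp
  ultimately have "2 + real r \<le> 2 * 2 ^ r" by simp
  then have "2 ^ s * (2 + real r) \<le> 2 ^ s * (2 * 2 ^ r)" by (intro mult_left_mono) auto
  then show ?thesis by (simp add: m power_add)
next
  case False
  show ?thesis
  proof (cases "s = Suc m")
    case True
    then show ?thesis by simp
  next
    case False
    then have "2 + real m - real s \<le> 0" using \<open>\<not> s \<le> m\<close> by simp
    then have "2 ^ s * (2 + real m - real s) \<le> 0" by (simp add: mult_nonneg_nonpos)
    then show ?thesis by (smt (verit) zero_le_power)
  qed
qed

lemma covers_if_large:
  assumes N: "2 ^ (32 * k) \<le> N" and k: "0 < k"
  shows "covers row {..<N} k"
proof (rule ccontr)
  \<comment> \<open>\<open>?s = ?n / 4\<close> is the lower bound on the average number of marks.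
    The factor 32 is large enough for \<open>(17 / 8) ^ 32 * 16 < 2 ^ 8 * 2 ^ 32\<close>, on which
    the final contradiction rests.\<close>
  let ?n = "32 * k" and ?s = "8 * k"
  let ?B = "block ?n 0"
  assume "\<not> covers row {..<N} k"
  moreover have B: "?B \<subseteq> {..<N}" using N by (auto simp: block_eq)
  ultimately have upper: "(\<Sum>j\<in>?B. 2 ^ marks ?n j :: real) \<le> (17 / 8) ^ ?n * 16 ^ k"
    using weight_le_if_not_covers[of ?B ?n 0 k] covers_mono by blast
  have "real (?n * 2 ^ ?n) \<le> real (4 * (\<Sum>j\<in>?B. marks ?n j))"
    using sum_marks_ge[of 0 ?n] N by (intro of_nat_mono) simp
  then have "real ?s * 2 ^ ?n \<le> (\<Sum>j\<in>?B. real (marks ?n j))" by simp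
  then have "2 * 2 ^ ?n \<le> (\<Sum>j\<in>?B. 2 + real (marks ?n j) - real ?s)"
    by (simp add: sum.distrib sum_subtractf algebra_simps)
  then have "2 ^ ?s * (2 * 2 ^ ?n) \<le> 2 ^ ?s * (\<Sum>j\<in>?B. 2 + real (marks ?n j) - real ?s)"
    by (intro mult_left_mono) auto
  also have "\<dots> = (\<Sum>j\<in>?B. 2 ^ ?s * (2 + real (marks ?n j) - real ?s))"
    by (rule sum_distrib_left)
  also have "\<dots> \<le> (\<Sum>j\<in>?B. 2 * 2 ^ marks ?n j)"
    by (intro sum_mono two_power_ge_tangent)
  also have "\<dots> = 2 * (\<Sum>j\<in>?B. 2 ^ marks ?n j)"
    by (simp add: sum_distrib_left)
  finally have "(2::real) ^ ?s * 2 ^ ?n \<le> (17 / 8) ^ ?n * 16 ^ k"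
    using upper by simp
  then have "(2 ^ 8 * 2 ^ 32 :: real) ^ k \<le> ((17 / 8) ^ 32 * 16) ^ k"
    by (simp only: power_mult power_mult_distrib)
  moreover have "((17 / 8) ^ 32 * 16 :: real) < 2 ^ 8 * 2 ^ 32"
    by (simp add: power_divide)
  then have "((17 / 8) ^ 32 * 16 :: real) ^ k < (2 ^ 8 * 2 ^ 32) ^ k"
    using k by (intro power_strict_mono) simp_all
  ultimately show False by linarith
qed

end

section \<open>The learner\<close>

fun ask :: "'a sample list \<Rightarrow> 'a \<Rightarrow> (bool list \<Rightarrow> bool) \<Rightarrow> 'a strategy" where
  "ask [] x f = Predict (f [])"
| "ask (W # Ws) x f = Query (W @ [(x, True)]) (\<lambda>a. ask Ws x (\<lambda>as. f (a # as)))"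

lemma queries_ask:
  "queries Orc (ask Ws x f) = map (\<lambda>W. (W @ [(x, True)], Orc (W @ [(x, True)]))) Ws"
  by (induction Ws arbitrary: f) auto

lemma outcome_ask: "outcome Orc (ask Ws x f) = f (map (\<lambda>W. Orc (W @ [(x, True)])) Ws)"
  by (induction Ws arbitrary: f) auto

text \<open>There is one answer per world, so \<open>length as\<close> is the number of the next
  mistake. Ties go to \<open>True\<close>.\<close>

definition vote :: "bool list \<Rightarrow> bool" where
  "vote as \<longleftrightarrow>
     card (voters (length as)) \<le> 2 * card {j \<in> voters (length as). as ! j}"

lemma vote_wrong:
  assumes "vote as \<noteq> y"
  shows "card (voters (length as)) \<le> 2 * card {j \<in> voters (length as). as ! j = (\<not> y)}"
proof (cases y)
  case True
  let ?A = "voters (length as)"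
  have "card ({j \<in> ?A. as ! j} \<union> {j \<in> ?A. \<not> as ! j})
      = card {j \<in> ?A. as ! j} + card {j \<in> ?A. \<not> as ! j}"
    by (intro card_Un_disjoint) auto
  moreover have "{j \<in> ?A. as ! j} \<union> {j \<in> ?A. \<not> as ! j} = ?A" by blast
  ultimately show ?thesis using assms True by (simp add: vote_def)
next
  case False
  then show ?thesis using assms by (simp add: vote_def)
qed

text \<open>Only mistakes change the worlds: each takes its oracle answer as label, and the last
  one, so far correct on all mistake points, also branches off a new world with the true
  label.\<close>

definition update :: "'a sample list \<Rightarrow> 'a round \<Rightarrow> 'a sample list" where
  "update Ws r = (if prediction r = label r then Ws
     else map2 (\<lambda>W e. W @ [(point r, snd e)]) Ws (exchanges r) @ [last Ws @ [(point r, label r)]])"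

definition worlds :: "'a round list \<Rightarrow> 'a sample list" where
  "worlds h = foldl update [[]] h"

definition dyadic_learner :: "'a learner" where
  "dyadic_learner h x = ask (worlds h) x vote"

text \<open>\<open>zs\<close> lists the mistake points with their true labels. The last two clauses
  provide \<open>correct\<close> and \<open>wrong\<close> of \<open>dyadic_majority\<close>, with
  the worlds as rows.\<close>

definition valid_state ::
  "('a \<Rightarrow> bool) set \<Rightarrow> ('a \<Rightarrow> bool) \<Rightarrow> 'a sample list \<Rightarrow> 'a sample \<Rightarrow> bool" where
  "valid_state C c Ws zs \<longleftrightarrow>
     length Ws = Suc (length zs) \<and> consistent c zs \<and>
     (\<forall>W\<in>set Ws. realizable C W \<and> length W = length zs) \<and>
     (\<forall>j<length Ws. take j (Ws ! j) = take j zs) \<and>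
     (\<forall>i. 0 < i \<longrightarrow> i < length Ws \<longrightarrow>
        card (voters i) \<le> 2 * card {j \<in> voters i.
          (fst (zs ! (i - 1)), \<not> snd (zs ! (i - 1))) \<in> set (Ws ! j)})"

lemma valid_state_Nil: "c \<in> C \<Longrightarrow> valid_state C c [[]] []"
  by (auto simp: valid_state_def consistent_def realizable_def)

text \<open>If label \<open>True\<close> at \<open>x\<close> is refuted, every concept consistent
  with \<open>W\<close> labels \<open>x\<close> by \<open>False\<close>; hence one query suffices to
  extend a world.\<close>

lemma realizable_extend:
  assumes "realizable C W"
  shows "realizable C (W @ [(x, realizable C (W @ [(x, True)]))])"
proof (cases "realizable C (W @ [(x, True)])")
  case False
  obtain c where c: "c \<in> C" "consistent c W" using assms by (auto simp: realizable_def)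
  have "\<not> c x"
  proof
    assume "c x"
    then have "consistent c (W @ [(x, True)])" using c by (auto simp: consistent_def)
    then show False using False c by (auto simp: realizable_def)
  qed
  then have "consistent c (W @ [(x, False)])" using c by (auto simp: consistent_def)
  then have "realizable C (W @ [(x, False)])" using c by (auto simp: realizable_def)
  then show ?thesis using False by simp
qed simp

lemma valid_state_extend:
  assumes valid: "valid_state C c Ws zs" and c: "c \<in> C"
    and as: "as = map (\<lambda>W. realizable C (W @ [(x, True)])) Ws"
    and mistake: "vote as \<noteq> c x"
  shows "valid_state C c (map2 (\<lambda>W a. W @ [(x, a)]) Ws as @ [last Ws @ [(x, c x)]]) (zs @ [(x, c x)])"
proof -
  let ?m = "length zs"
  let ?Ws = "map2 (\<lambda>W a. W @ [(x, a)]) Ws as @ [last Ws @ [(x, c x)]]"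
  let ?zs = "zs @ [(x, c x)]"
  have len: "length Ws = Suc ?m" and con: "consistent c zs"
    and W: "\<And>W. W \<in> set Ws \<Longrightarrow> realizable C W \<and> length W = ?m"
    and take: "\<And>j. j < length Ws \<Longrightarrow> take j (Ws ! j) = take j zs"
    and wrong: "\<And>i. 0 < i \<Longrightarrow> i < length Ws \<Longrightarrow>
        card (voters i) \<le> 2 * card {j \<in> voters i.
          (fst (zs ! (i - 1)), \<not> snd (zs ! (i - 1))) \<in> set (Ws ! j)}"
    using valid unfolding valid_state_def by blast+
  have "Ws \<noteq> []" using len by auto
  have lenW: "length (Ws ! j) = ?m" if "j < length Ws" for j using W that by auto
  \<comment> \<open>The last world has index and length \<open>?m\<close>, so agreement on the first
    \<open>?m\<close> entries is equality.\<close>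
  have last: "last Ws = zs"
  proof -
    have "last Ws = Ws ! ?m" using len \<open>Ws \<noteq> []\<close> by (simp add: last_conv_nth)
    then show ?thesis using take[of ?m] lenW[of ?m] len by simp
  qed
  have lenas: "length as = length Ws" by (simp add: as)
  have nth: "?Ws ! j = Ws ! j @ [(x, as ! j)]" if "j < length Ws" for j
    using that lenas by (simp add: nth_append)
  have con': "consistent c ?zs" using con by (auto simp: consistent_def)
  have "realizable C W' \<and> length W' = Suc ?m" if W': "W' \<in> set ?Ws" for W'
  proof (cases "W' = ?zs")
    case True
    then show ?thesis using con' c by (auto simp: realizable_def)
  next
    case False
    then obtain j where j: "j < length Ws" "W' = Ws ! j @ [(x, as ! j)]"
      using W' lenas last by (auto simp: set_zip)
    then show ?thesis using W[of "Ws ! j"] realizable_extend[of C "Ws ! j" x] by (simp add: as)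
  qed
  moreover have "take j (?Ws ! j) = take j ?zs" if "j < length ?Ws" for j
  proof (cases "j < length Ws")
    case True
    then show ?thesis using take[OF True] lenW[OF True] nth[OF True] len by simp
  next
    case False
    then have "j = length Ws" using that lenas by simp
    then show ?thesis using last lenas by (simp add: nth_append)
  qed
  moreover have "card (voters i) \<le> 2 * card {j \<in> voters i.
      (fst (?zs ! (i - 1)), \<not> snd (?zs ! (i - 1))) \<in> set (?Ws ! j)}"
    if i: "0 < i" "i < length ?Ws" for i
  proof (cases "i < length Ws")
    \<comment> \<open>An earlier mistake: appending only adds entries to the rows, so no wrong vote
      is lost.\<close>
    case True
    have "card {j \<in> voters i.
        (fst (zs ! (i - 1)), \<not> snd (zs ! (i - 1))) \<in> set (Ws ! j)}
      \<le> card {j \<in> voters i.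
        (fst (?zs ! (i - 1)), \<not> snd (?zs ! (i - 1))) \<in> set (?Ws ! j)}"
      using True i nth len by (intro card_mono) (auto simp: nth_append[of zs] dest: voters_less)
    then show ?thesis using wrong[OF i(1) True] by linarith
  next
    \<comment> \<open>The new mistake: all its voters are old worlds, whose label at
      \<open>x\<close> is their answer.\<close>
    case False
    then have i': "i = length as" using i lenas by simp
    have "card {j \<in> voters i. as ! j = (\<not> c x)}
      \<le> card {j \<in> voters i.
        (fst (?zs ! (i - 1)), \<not> snd (?zs ! (i - 1))) \<in> set (?Ws ! j)}"
      using i' nth len lenas by (intro card_mono) (auto dest: voters_less)
    then show ?thesis using vote_wrong[OF mistake, folded i'] by linarith
  qed
  ultimately show ?thesis using con' len lenas unfolding valid_state_def by auto
qed

section \<open>Runs of the learner and the mistake bound\<close>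

lemma play_snoc:
  "play L Orc c (xs @ [x]) = play L Orc c xs @ [play_round L Orc c (play L Orc c xs) x]"
  by (simp add: play_def)

text \<open>A round costs one query per world, that is, one more than the mistakes so far; as
  mistakes never decrease, their final number bounds the cost of every round.\<close>

lemma play_dyadic_learner:
  fixes C :: "('a \<Rightarrow> bool) set"
  assumes "c \<in> C"
  defines "h \<equiv> play dyadic_learner (weak_consistency_oracle C) c"
  shows "(\<exists>zs. length zs = mistakes (h xs) \<and> valid_state C c (worlds (h xs)) zs) \<and>
    oracle_calls (h xs) \<le> length xs * Suc (mistakes (h xs))"
proof (induction xs rule: rev_induct)
  case Nil
  show ?case using assms(1)
    by (auto simp: h_def play_def worlds_def mistakes_def oracle_calls_def valid_state_Nil)
next
  case (snoc x xs)
  let ?Orc = "weak_consistency_oracle C" and ?Ws = "worlds (h xs)"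
  let ?as = "map (\<lambda>W. realizable C (W @ [(x, True)])) ?Ws"
  obtain zs where zs: "length zs = mistakes (h xs)" "valid_state C c ?Ws zs" using snoc.IH by blast
  define r where "r = play_round dyadic_learner ?Orc c (h xs) x"
  have h: "h (xs @ [x]) = h xs @ [r]" by (simp add: h_def play_snoc r_def)
  have r: "point r = x" "label r = c x" "prediction r = vote ?as"
    "exchanges r = map (\<lambda>W. (W @ [(x, True)], realizable C (W @ [(x, True)]))) ?Ws"
    by (simp_all add: r_def play_round_def dyadic_learner_def queries_ask outcome_ask
        weak_consistency_oracle_def)
  have lenWs: "length ?Ws = Suc (mistakes (h xs))" using zs by (simp add: valid_state_def)
  have calls: "oracle_calls (h (xs @ [x])) = oracle_calls (h xs) + Suc (mistakes (h xs))"
    by (simp add: h oracle_calls_def r lenWs)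
  show ?case
  proof (cases "vote ?as = c x")
    case True
    then have "worlds (h (xs @ [x])) = ?Ws" "mistakes (h (xs @ [x])) = mistakes (h xs)"
      by (simp_all add: h worlds_def update_def mistakes_def r)
    then show ?thesis using zs snoc.IH calls by auto
  next
    case False
    have m: "mistakes (h (xs @ [x])) = Suc (mistakes (h xs))"
      using False by (simp add: h mistakes_def r)
    have "map2 (\<lambda>W e. W @ [(point r, snd e)]) ?Ws (exchanges r) = map2 (\<lambda>W a. W @ [(x, a)]) ?Ws ?as"
      by (simp add: r zip_map2 case_prod_unfold)
    then have "worlds (h (xs @ [x])) =
        map2 (\<lambda>W a. W @ [(x, a)]) ?Ws ?as @ [last ?Ws @ [(x, c x)]]"
      using False by (simp add: h worlds_def update_def r)
    then have "valid_state C c (worlds (h (xs @ [x]))) (zs @ [(x, c x)])"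
      using valid_state_extend[OF zs(2) assms(1) refl False] by simp
    moreover have "length (zs @ [(x, c x)]) = mistakes (h (xs @ [x]))" using zs m by simp
    moreover have "oracle_calls (h (xs @ [x])) \<le> length (xs @ [x]) * Suc (mistakes (h (xs @ [x])))"
      using snoc.IH calls m by simp
    ultimately show ?thesis by blast
  qed
qed

text \<open>Otherwise the worlds, taken as rows, would cover depth \<open>Suc d\<close> and, being
  realizable, yield a shattered tree that is too deep.\<close>

lemma length_worlds_less:
  assumes valid: "valid_state C c Ws zs" and dim: "littlestone_dim C = enat d"
  shows "length Ws < 2 ^ (32 * Suc d)"
proof (rule ccontr)
  assume large: "\<not> length Ws < 2 ^ (32 * Suc d)"
  interpret dyadic_majority "\<lambda>j. Ws ! j" "\<lambda>i. zs ! i" "length Ws"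
  proof
    fix i j assume ij: "0 < i" "i \<le> j" "j < length Ws"
    have "take j (Ws ! j) = take j zs" "length zs = length (Ws ! j)" "j \<le> length zs"
      using valid ij by (auto simp: valid_state_def)
    then have "Ws ! j ! (i - 1) = zs ! (i - 1)" "i - 1 < length (Ws ! j)"
      using ij nth_take[of "i - 1" j "Ws ! j"] nth_take[of "i - 1" j zs] by auto
    then show "zs ! (i - 1) \<in> set (Ws ! j)" by (metis nth_mem)
  next
    fix i assume "0 < i" "i < length Ws"
    then show "card (voters i) \<le> 2 * card {j \<in> voters i.
        (fst (zs ! (i - 1)), \<not> snd (zs ! (i - 1))) \<in> set (Ws ! j)}"
      using valid unfolding valid_state_def by blast
  qed
  have "covers (\<lambda>j. Ws ! j) {..<length Ws} (Suc d)"
    using covers_if_large[of "Suc d"] large by simp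
  then have "enat (Suc d) \<le> littlestone_dim C"
    by (rule covers_imp_littlestone_dim_ge) (use valid in \<open>auto simp: valid_state_def\<close>)
  then show False using dim by simp
qed

theorem corollary3p4:
  "\<exists>K::real. 0 < K \<and> K \<le> 1000 \<and>
     (\<forall>(d::nat) (T::nat). 1 \<le> d \<longrightarrow> 1 \<le> T \<longrightarrow>
        (\<exists>L :: 'a learner.
           \<forall>C \<in> littlestone_family d. \<forall>c \<in> C. \<forall>xs :: 'a list. length xs = T \<longrightarrow>
             real (oracle_calls (play L (weak_consistency_oracle C) c xs))
               \<le> real T * 2 powr (K * real d) \<and>
             real (mistakes (play L (weak_consistency_oracle C) c xs))
               \<le> 2 powr (K * real d)))"
proof (intro exI[of _ 64] conjI allI impI exI[of _ dyadic_learner] ballI)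
  fix d T :: nat and C :: "('a \<Rightarrow> bool) set" and c and xs :: "'a list"
  assume d: "1 \<le> d" and C: "C \<in> littlestone_family d" and c: "c \<in> C" and T: "length xs = T"
  let ?h = "play dyadic_learner (weak_consistency_oracle C) c xs"
  obtain zs where zs: "length zs = mistakes ?h" "valid_state C c (worlds ?h) zs"
    and calls: "oracle_calls ?h \<le> T * Suc (mistakes ?h)"
    using play_dyadic_learner[OF c, of xs] T by blast
  have "Suc (mistakes ?h) < 2 ^ (32 * Suc d)"
    using length_worlds_less[OF zs(2)] C zs by (simp add: littlestone_family_def valid_state_def)
  \<comment> \<open>The constant 64 absorbs the excess of \<open>Suc d\<close> over
    \<open>d\<close>: \<open>32 * Suc d \<le> 64 * d\<close> for \<open>d \<ge> 1\<close>.\<close>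
  also have "\<dots> \<le> 2 ^ (64 * d)" using d by (intro power_increasing) auto
  finally have "real (Suc (mistakes ?h)) \<le> real (2 ^ (64 * d))"
    by (intro of_nat_mono) simp
  also have "\<dots> = 2 powr (64 * real d)"
    by (simp add: powr_realpow[symmetric])
  finally have m: "real (Suc (mistakes ?h)) \<le> 2 powr (64 * real d)" .
  then show "real (mistakes ?h) \<le> 2 powr (64 * real d)" by simp
  have "real (oracle_calls ?h) \<le> real T * real (Suc (mistakes ?h))"
    using calls by (metis of_nat_le_iff of_nat_mult)
  also have "\<dots> \<le> real T * 2 powr (64 * real d)" using m by (intro mult_left_mono) auto
  finally show "real (oracle_calls ?h) \<le> real T * 2 powr (64 * real d)" .
qed auto

end
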